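(* Let $q$ be a prime power. Any two involutions in $\mathrm{PSL}(2,q)$ are conjugate by an element of odd order; that is, for any involutions $t_1,t_2\in \mathrm{PSL}(2,q)$ there exists an element $g\in \mathrm{PSL}(2,q)$ of odd order such that $t_2=g^{-1}t_1g$.
   Context: $\mathrm{PSL}(2,q)$ denotes the projective special linear group of degree 2 over the finite field with $q$ elements. An involution is an element of order exactly $2$. The identity has order $1$, which is odd. *)

theory Defs
  imports
    "HOL-Algebra.Algebra"
    "HOL-Analysis.Determinants"
    "HOL-Number_Theory.Prime_Powers"
begin

definition SL2 :: "'a::field itself \<Rightarrow> ('a^2^2) monoid" where
  "SL2 _ = \<lparr>carrier = {A. det A = 1}, monoid.mult = (**), one = mat 1\<rparr>"

definition SL2_scalars :: "'a::field itself \<Rightarrow> ('a^2^2) set" where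
  "SL2_scalars F = {A \<in> carrier (SL2 F). \<exists>c. A = mat c}"

text \<open>The argument of type \<^typ>\<open>'a itself\<close> only fixes the field; in the statement it is an
  arbitrary field with \<open>q\<close> elements. The scalar matrices of determinant 1 form the centre of the
  special linear group, and the elements of the quotient are their cosets.\<close>

definition PSL2 :: "'a::field itself \<Rightarrow> ('a^2^2) set monoid" where
  "PSL2 F = SL2 F Mod SL2_scalars F"

definition involution :: "('b, 'm) monoid_scheme \<Rightarrow> 'b \<Rightarrow> bool" where
  "involution G t \<longleftrightarrow> t \<in> carrier G \<and> group.ord G t = 2"

lemma group_SL2: "group (SL2 F)"
proof (rule groupI)
  fix A assume A: "A \<in> carrier (SL2 F)"
  then have "invertible A"
    by (simp add: SL2_def invertible_det_nz)
  then obtain B where B: "B ** A = mat 1"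
    by (auto simp: invertible_def)
  then have "det B * det A = 1"
    by (metis det_mul det_I)
  with A B show "\<exists>B\<in>carrier (SL2 F). B \<otimes>\<^bsub>SL2 F\<^esub> A = \<one>\<^bsub>SL2 F\<^esub>"
    by (auto simp: SL2_def)
qed (auto simp: SL2_def det_mul matrix_mul_assoc)

lemma scalar_commute: "mat c ** A = A ** mat c"
  for A :: "'a::field^2^2"
  by (simp add: vec_eq_iff matrix_matrix_mult_def mat_def sum_2 forall_2)

lemma normal_SL2_scalars: "SL2_scalars F \<lhd> SL2 F"
proof -
  interpret group "SL2 F" by (rule group_SL2)
  have mm: "mat c ** mat d = (mat (c * d) :: 'a^2^2)" for c d
    by (simp add: vec_eq_iff matrix_matrix_mult_def mat_def sum_2 forall_2)
  have cent: "A \<otimes>\<^bsub>SL2 F\<^esub> B = B \<otimes>\<^bsub>SL2 F\<^esub> A" if "A \<in> SL2_scalars F" for A B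
    using that by (auto simp: SL2_scalars_def SL2_def scalar_commute)
  have sub: "subgroup (SL2_scalars F) (SL2 F)"
  proof (rule subgroupI)
    show "SL2_scalars F \<subseteq> carrier (SL2 F)"
      by (auto simp: SL2_scalars_def)
    show "SL2_scalars F \<noteq> {}"
      by (auto simp: SL2_scalars_def SL2_def intro!: exI[of _ "mat 1"])
  next
    fix A assume A: "A \<in> SL2_scalars F"
    then obtain c where c: "A = mat c" and d: "det A = 1"
      by (auto simp: SL2_scalars_def SL2_def)
    then have cc: "c * c = 1"
      by (simp add: det_2 mat_def)
    have "inv\<^bsub>SL2 F\<^esub> A = A"
      by (rule inv_equality) (use c d cc in \<open>auto simp: SL2_def mm\<close>)
    with A show "inv\<^bsub>SL2 F\<^esub> A \<in> SL2_scalars F"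
      by simp
  next
    fix A B assume "A \<in> SL2_scalars F" "B \<in> SL2_scalars F"
    then show "A \<otimes>\<^bsub>SL2 F\<^esub> B \<in> SL2_scalars F"
      by (auto simp: SL2_scalars_def SL2_def det_mul mm)
  qed
  show ?thesis
    unfolding normal_inv_iff
  proof (intro conjI ballI sub)
    fix x h assume x: "x \<in> carrier (SL2 F)" and h: "h \<in> SL2_scalars F"
    have hc: "h \<in> carrier (SL2 F)" using h by (simp add: SL2_scalars_def)
    have "x \<otimes>\<^bsub>SL2 F\<^esub> h \<otimes>\<^bsub>SL2 F\<^esub> inv\<^bsub>SL2 F\<^esub> x = h"
      using cent[OF h, of x] x hc by (metis inv_solve_right' m_closed)
    with h show "x \<otimes>\<^bsub>SL2 F\<^esub> h \<otimes>\<^bsub>SL2 F\<^esub> inv\<^bsub>SL2 F\<^esub> x \<in> SL2_scalars F"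
      by simp
  qed
qed

lemma group_PSL2: "group (PSL2 F)"
  unfolding PSL2_def by (rule normal.factorgroup_is_group[OF normal_SL2_scalars])

end

theory Submission
  imports Defs
begin

text \<open>
  An element of the special linear group represents an involution of the quotient exactly when
  it is a nonscalar matrix of determinant 1 and trace 0. So let \<open>A\<close>, \<open>B\<close> be two such matrices; a
  matrix \<open>g\<close> of determinant 1 with \<open>A g = g B\<close> or \<open>A g = - g B\<close> is wanted whose image has odd order.

  Odd order can be read off from the trace. If the image of \<open>g\<close> has even order, some power \<open>h\<close> of
  \<open>g\<close> represents an involution. Since \<open>g\<close> commutes with the nonscalar matrix \<open>h\<close>, it has the form
  \<open>a + b h\<close>, and then \<open>trace g = 2 a\<close> and \<open>1 = det g = a\<^sup>2 + b\<^sup>2\<close>. Hence the image of \<open>g\<close> has odd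
  order as soon as \<open>(trace g)\<^sup>2 + 4 b\<^sup>2 = 4\<close> has no solution \<open>b \<noteq> 0\<close> (lemma \<open>odd_ord_coset\<close>).

  The solutions of \<open>A g = g B\<close> include \<open>(A + B) (y - x B)\<close>, which has determinant \<open>c (x\<^sup>2 + y\<^sup>2)\<close> and
  trace \<open>c x\<close> for \<open>c = 2 - trace (A B)\<close>. If \<open>c \<noteq> 0\<close>, the traces \<open>\<tau>\<close> available in determinant 1 are
  those for which \<open>\<tau>\<^sup>2 + w\<^sup>2 = c\<close> is solvable. For odd \<open>q\<close>, counting shows that one of them passes the
  trace test: the circles \<open>\<tau>\<^sup>2 + w\<^sup>2 = c\<close> and \<open>\<tau>\<^sup>2 + u\<^sup>2 = 4\<close> have equally many points, projecting to
  the first coordinate is at most two-to-one on the former, and on the latter every forbidden \<open>\<tau>\<close>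
  uses up two points while \<open>(2, 0)\<close> is left over. So the available traces outnumber the forbidden
  ones (lemma \<open>exists_trace\<close>).

  If \<open>c = 0\<close> and \<open>q\<close> is odd, replacing \<open>B\<close> by \<open>- B\<close>, which represents the same involution, turns
  \<open>c\<close> into 4. If \<open>c = 0\<close> and \<open>q\<close> is even, \<open>A - 1\<close> and \<open>B - 1\<close> are proportional nilpotent matrices,
  and if they are distinct, a triangular matrix of nonzero trace conjugates one to the other.
\<close>

section \<open>Two-by-two matrices\<close>

lemma mat2_eq_iff: "A = B \<longleftrightarrow> A$1$1 = B$1$1 \<and> A$1$2 = B$1$2 \<and> A$2$1 = B$2$1 \<and> A$2$2 = B$2$2"
  for A B :: "'a^2^2"
  by (auto simp: vec_eq_iff forall_2)

lemmas mat2_simps =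
  mat2_eq_iff det_2 trace_def sum_2 matrix_matrix_mult_def mat_def

lemma Cayley_Hamilton_2: "A ** A = mat (trace A) ** A - mat (det A)"
  for A :: "'a::field^2^2"
  by (simp add: mat2_simps algebra_simps)

text \<open>The quantities \<open>g\<^sub>1\<^sub>2\<close>, \<open>g\<^sub>2\<^sub>1\<close>, \<open>g\<^sub>1\<^sub>1 - g\<^sub>2\<^sub>2\<close> determine a matrix up to adding a scalar matrix,
  and two matrices commute exactly when these triples are linearly dependent. The triple of a
  nonscalar matrix is nonzero, so the triple of \<open>g\<close> is a multiple of that of \<open>h\<close>.\<close>

lemma commutant_nonscalar:
  fixes g h :: "'a::field^2^2"
  assumes "\<And>c. h \<noteq> mat c" and "g ** h = h ** g"
  obtains a b where "g = mat a + mat b ** h"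
proof -
  have comm: "g$1$2 * h$2$1 = g$2$1 * h$1$2"
      "(g$1$1 - g$2$2) * h$1$2 = g$1$2 * (h$1$1 - h$2$2)"
      "(g$1$1 - g$2$2) * h$2$1 = g$2$1 * (h$1$1 - h$2$2)"
  proof -
    have e: "g$1$1 * h$1$1 + g$1$2 * h$2$1 = h$1$1 * g$1$1 + h$1$2 * g$2$1"
        "g$1$1 * h$1$2 + g$1$2 * h$2$2 = h$1$1 * g$1$2 + h$1$2 * g$2$2"
        "g$2$1 * h$1$1 + g$2$2 * h$2$1 = h$2$1 * g$1$1 + h$2$2 * g$2$1"
      using assms(2) by (simp_all add: mat2_eq_iff matrix_matrix_mult_def sum_2)
    show "g$1$2 * h$2$1 = g$2$1 * h$1$2"
      using e(1) by (simp add: mult.commute)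
    have "(g$1$1 - g$2$2) * h$1$2 - g$1$2 * (h$1$1 - h$2$2)
        = (g$1$1 * h$1$2 + g$1$2 * h$2$2) - (h$1$1 * g$1$2 + h$1$2 * g$2$2)"
      by (simp add: algebra_simps)
    then show "(g$1$1 - g$2$2) * h$1$2 = g$1$2 * (h$1$1 - h$2$2)"
      unfolding e(2) by simp
    have "(g$1$1 - g$2$2) * h$2$1 - g$2$1 * (h$1$1 - h$2$2)
        = (h$2$1 * g$1$1 + h$2$2 * g$2$1) - (g$2$1 * h$1$1 + g$2$2 * h$2$1)"
      by (simp add: algebra_simps)
    then show "(g$1$1 - g$2$2) * h$2$1 = g$2$1 * (h$1$1 - h$2$2)"
      unfolding e(3) by simp
  qed
  have ratio: "\<exists>b. u = b * p \<and> v = b * q \<and> w = b * r"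
    if "p \<noteq> 0" "u * q = v * p" "u * r = w * p" for p q r u v w :: 'a
    by (rule exI[of _ "u / p"]) (use that in \<open>simp add: field_simps\<close>)
  consider "h$1$2 \<noteq> 0" | "h$2$1 \<noteq> 0" | "h$1$1 - h$2$2 \<noteq> 0"
    using assms(1)[of "h$1$1"] by (auto simp: mat2_eq_iff mat_def)
  then have "\<exists>b. g$1$2 = b * h$1$2 \<and> g$2$1 = b * h$2$1 \<and> g$1$1 - g$2$2 = b * (h$1$1 - h$2$2)"
  proof cases
    case 1
    from ratio[OF this comm(1) comm(2)[symmetric]] show ?thesis by blast
  next
    case 2
    from ratio[OF this comm(1,3)[symmetric]] show ?thesis by blast
  next
    case 3
    from ratio[OF this comm(2,3)] show ?thesis by blast
  qed
  then obtain b where b: "g$1$2 = b * h$1$2" "g$2$1 = b * h$2$1"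
      "g$1$1 - g$2$2 = b * (h$1$1 - h$2$2)"
    by blast
  from b(3) have "g$2$2 = g$1$1 - b * h$1$1 + b * h$2$2"
    by (simp add: algebra_simps)
  with b(1,2) show thesis
    by (intro that[of "g$1$1 - b * h$1$1" b])
      (simp add: mat2_eq_iff matrix_matrix_mult_def sum_2 mat_def)
qed

lemma det_add_traceless:
  fixes A B :: "'a::field^2^2"
  assumes "trace A = 0" "trace B = 0"
  shows "det (A + B) = det A + det B - trace (A ** B)"
proof -
  have "A$2$2 = - A$1$1" "B$2$2 = - B$1$1"
    using assms by (simp_all add: mat2_simps add_eq_0_iff)
  then show ?thesis
    by (simp add: mat2_simps algebra_simps)
qed

lemma traceless_square:
  fixes A :: "'a::field^2^2"
  assumes "det A = 1" "trace A = 0"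
  shows "A ** A = - mat 1"
proof -
  have "mat 0 ** A = 0"
    by (simp add: mat2_simps)
  with Cayley_Hamilton_2[of A] assms show ?thesis
    by simp
qed

text \<open>The matrix \<open>A + B\<close> intertwines \<open>A\<close> and \<open>B\<close> because \<open>A\<^sup>2 = - 1 = B\<^sup>2\<close>, and multiplying it on the
  right by anything that commutes with \<open>B\<close> keeps this property.\<close>

lemma traceless_conj:
  fixes A B :: "'a::field^2^2"
  assumes A: "det A = 1" "trace A = 0" and B: "det B = 1" "trace B = 0"
  defines "g \<equiv> \<lambda>x y. (A + B) ** (mat y - mat x ** B)"
  defines "c \<equiv> 2 - trace (A ** B)"
  shows "A ** g x y = g x y ** B"
    and "det (g x y) = c * (x^2 + y^2)"
    and "trace (g x y) = c * x"
proof -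
  have AB: "A ** (A + B) = (A + B) ** B"
    using traceless_square[OF A] traceless_square[OF B]
    by (simp add: mat2_simps algebra_simps)
  have comm: "B ** (mat y - mat x ** B) = (mat y - mat x ** B) ** B"
    by (simp add: mat2_simps algebra_simps)
  show "A ** g x y = g x y ** B"
    unfolding g_def by (metis AB comm matrix_mul_assoc)
  have "det (mat y - mat x ** B) = y^2 - x * y * trace B + x^2 * det B"
    by (simp add: mat2_simps power2_eq_square algebra_simps)
  then show "det (g x y) = c * (x^2 + y^2)"
    by (simp add: g_def c_def det_mul det_add_traceless A B)
  have "trace (g x y) = y * (trace A + trace B) - x * (trace (A ** B) + trace (B ** B))"
    by (simp add: g_def mat2_simps algebra_simps)
  moreover have "trace (B ** B) = - 2"
    using traceless_square[OF B] by (simp add: mat2_simps)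
  ultimately show "trace (g x y) = c * x"
    by (simp add: c_def A B algebra_simps)
qed

text \<open>Two nilpotent matrices with kernels \<open>\<langle>v\<rangle>\<close> and \<open>\<langle>w\<rangle>\<close> have a product of trace proportional to
  \<open>det (v, w)\<^sup>2\<close>. If this trace vanishes, they share their kernel, which determines a nilpotent
  matrix up to a factor. The proof carries this out in terms of entries: the factor \<open>l\<close> is the
  ratio of two off-diagonal entries.\<close>

lemma nilpotent_proportional:
  fixes N M :: "'a::field^2^2"
  assumes N: "trace N = 0" "det N = 0" "N \<noteq> 0" and M: "trace M = 0" "det M = 0"
    and NM: "trace (N ** M) = 0"
  obtains l where "M = mat l ** N"
proof -
  define n b c where N_def: "n = N$1$1" "b = N$1$2" "c = N$2$1"
  define m e f where M_def: "m = M$1$1" "e = M$1$2" "f = M$2$1"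
  have 22: "N$2$2 = - n" "M$2$2 = - m"
    using N(1) M(1) by (simp_all add: mat2_simps N_def M_def add_eq_0_iff)
  have n: "n * n = - (b * c)" and m: "m * m = - (e * f)"
    using N(2) M(2) by (simp_all add: det_2 22 minus_equation_iff flip: N_def M_def)
  have nm: "2 * (n * m) + b * f + c * e = 0"
    using NM by (simp add: mat2_simps 22 algebra_simps flip: N_def M_def)
  have "\<exists>l. e = l * b \<and> f = l * c \<and> m = l * n"
  proof (cases "b = 0")
    case True
    then have "n = 0" using n by simp
    moreover from this True have "c \<noteq> 0"
      using N(3) by (auto simp: mat2_eq_iff 22 simp flip: N_def)
    moreover from this have "e = 0"
      using nm \<open>n = 0\<close> True by simp
    moreover from this have "m = 0"
      using m by simp
    ultimately show ?thesis
      using True by (intro exI[of _ "f / c"]) simp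
  next
    case False
    define l where "l = e / b"
    have e: "e = l * b"
      using False by (simp add: l_def)
    have "(m - l * n) * (m - l * n) = m * m + l * l * (n * n) - l * (2 * (n * m))"
      by (simp add: algebra_simps)
    also have "2 * (n * m) = - (b * f) - c * e"
      using nm by (simp add: algebra_simps eq_neg_iff_add_eq_0)
    finally have "(m - l * n) * (m - l * n) = 0"
      by (simp add: n m e algebra_simps)
    then have ml: "m = l * n" by simp
    have "b * f = - (2 * l * (n * n)) - c * e"
      using nm by (simp add: ml algebra_simps eq_neg_iff_add_eq_0)
    then have "b * f = b * (l * c)"
      by (simp add: n e algebra_simps)
    then have "f = l * c"
      using False by simp
    with e ml show ?thesis by blast
  qed
  then obtain l where "e = l * b" "f = l * c" "m = l * n" by blast
  then show thesis
    by (intro that[of l]) (simp add: mat2_eq_iff matrix_matrix_mult_def sum_2 mat_def 22 flip: N_def M_def)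
qed

text \<open>Choose \<open>X\<close> with \<open>trace (X N) = 1\<close>. As \<open>N\<close> has rank one, \<open>N X N = trace (X N) N = N\<close>, so
  \<open>g = x (1 + (l - 1) X N)\<close> satisfies \<open>N g = x l N = g (l N)\<close>; its determinant is \<open>x\<^sup>2 l\<close>. Below, \<open>X\<close> has
  a single nonzero entry, placed opposite a nonzero off-diagonal entry of \<open>N\<close>.\<close>

lemma nilpotent_rescale:
  fixes N :: "'a::field^2^2"
  assumes N: "trace N = 0" "det N = 0" "N \<noteq> 0" and x: "x^2 * l = 1"
  obtains g where "det g = 1" and "N ** g = g ** (mat l ** N)" and "trace g = x * (1 + l)"
proof -
  define n b c where N_def: "n = N$1$1" "b = N$1$2" "c = N$2$1"
  have 22: "N$2$2 = - n"
    using N(1) by (simp_all add: mat2_simps N_def add_eq_0_iff)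
  have n: "n * n = - (b * c)"
    using N(2) by (simp_all add: det_2 22 minus_equation_iff flip: N_def)
  have x': "x * (l * x) = 1"
    using x by (simp add: power2_eq_square algebra_simps)
  show thesis
  proof (cases "b = 0")
    case True
    then have "n = 0" using n by simp
    define g :: "'a^2^2" where "g = vector [vector [l * x, 0], vector [0, x]]"
    have g: "g$1$1 = l * x" "g$1$2 = 0" "g$2$1 = 0" "g$2$2 = x"
      by (simp_all add: g_def)
    show thesis
    proof (rule that[of g])
      show "det g = 1"
        using x' by (simp add: det_2 g algebra_simps)
      show "N ** g = g ** (mat l ** N)"
        using True \<open>n = 0\<close>
        by (simp add: mat2_eq_iff matrix_matrix_mult_def sum_2 mat_def g 22 algebra_simps flip: N_def)
      show "trace g = x * (1 + l)"
        by (simp add: trace_def sum_2 g algebra_simps)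
    qed
  next
    case False
    define k where "k = x * (l - 1) * n / b"
    define g :: "'a^2^2" where "g = vector [vector [x, 0], vector [k, l * x]]"
    have g: "g$1$1 = x" "g$1$2 = 0" "g$2$1 = k" "g$2$2 = l * x"
      by (simp_all add: g_def)
    have bk: "b * k = x * (l - 1) * n"
      using False by (simp add: k_def)
    have "b * (n * k) = n * (b * k)" by simp
    also have "\<dots> = x * (l - 1) * (n * n)" by (simp add: bk)
    also have "\<dots> = b * (- (x * (l - 1) * c))" by (simp add: n algebra_simps)
    finally have nk: "n * k = - (x * (l - 1) * c)"
      using False by (metis mult_left_cancel)
    show thesis
    proof (rule that[of g])
      show "det g = 1"
        using x' by (simp add: det_2 g algebra_simps)
      have "n * x + b * k = x * (l * n)"
        by (simp add: bk algebra_simps)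
      moreover have "c * x - n * k = k * (l * n) + l * x * (l * c)"
      proof -
        have "k * (l * n) = l * (n * k)" by simp
        then show ?thesis unfolding nk by (simp add: algebra_simps)
      qed
      moreover have "- (n * (l * x)) = k * (l * b) - l * x * (l * n)"
      proof -
        have "k * (l * b) = l * (b * k)" by simp
        then show ?thesis unfolding bk by (simp add: algebra_simps)
      qed
      ultimately show "N ** g = g ** (mat l ** N)"
        by (simp add: mat2_eq_iff matrix_matrix_mult_def sum_2 mat_def g 22 flip: N_def)
      show "trace g = x * (1 + l)"
        by (simp add: trace_def sum_2 g algebra_simps)
    qed
  qed
qed

section \<open>Sums of two squares in a finite field\<close>

text \<open>Squaring is at most two-to-one, and 0 has only one square root.\<close>

lemma card_UNIV_less_squares:
  "CARD('a::{field,finite}) < 2 * card (range (\<lambda>x::'a. x^2))"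
proof -
  define S where "S = range (\<lambda>x::'a. x^2)"
  define r where "r = (\<lambda>s::'a. SOME x. x^2 = s)"
  have r: "r s ^ 2 = s" if "s \<in> S" for s
    using that unfolding S_def r_def by (auto intro: someI2)
  define f where "f = (\<lambda>(s, b). if b then r s else - r s)"
  have "x \<in> insert 0 (f ` ((S - {0}) \<times> UNIV))" for x
  proof (cases "x = 0")
    case False
    then have "x^2 \<in> S - {0}" by (simp add: S_def)
    moreover from this have "x = r (x^2) \<or> x = - r (x^2)"
      using r[of "x^2"] by (metis DiffD1 power2_eq_iff)
    then have "x = f (x^2, True) \<or> x = f (x^2, False)"
      by (simp add: f_def)
    ultimately show ?thesis by blast
  qed simp
  then have "CARD('a) \<le> card (insert 0 (f ` ((S - {0}) \<times> UNIV)))"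
    by (intro card_mono) auto
  also have "\<dots> \<le> Suc (card (f ` ((S - {0}) \<times> UNIV)))"
    by (rule card_insert_le_m1) auto
  also have "\<dots> \<le> Suc (card ((S - {0}) \<times> (UNIV :: bool set)))"
    by (intro Suc_le_mono[THEN iffD2] card_image_le) simp
  also have "\<dots> = Suc (2 * (card S - 1))"
    by (simp add: S_def image_iff card_cartesian_product mult.commute)
  also have "\<dots> < 2 * card S"
    using card_gt_0_iff[of S] by (simp add: S_def)
  finally show ?thesis
    by (simp add: S_def)
qed

text \<open>More than half of the elements are squares, so the sets of all \<open>a\<^sup>2\<close> and of all \<open>c - b\<^sup>2\<close> meet.\<close>

lemma sum_of_two_squares_exists:
  fixes c :: "'a::{field,finite}"
  obtains a b where "a^2 + b^2 = c"
proof -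
  let ?S = "range (\<lambda>x::'a. x^2)"
  have "card ((-) c ` ?S) = card ?S"
    by (intro card_image) (auto simp: inj_on_def)
  moreover have "card (?S \<union> (-) c ` ?S) \<le> CARD('a)"
    by (intro card_mono) auto
  ultimately have "?S \<inter> (-) c ` ?S \<noteq> {}"
    using card_UNIV_less_squares[where 'a = 'a] card_Un_disjoint[of ?S "(-) c ` ?S"] by auto
  then obtain a b where "a^2 = c - b^2" by auto
  then show thesis by (intro that[of a b]) simp
qed

definition circle :: "'a::field \<Rightarrow> ('a \<times> 'a) set" where
  "circle c = {(x, y). x^2 + y^2 = c}"

text \<open>With \<open>a\<^sup>2 + b\<^sup>2 = d / c\<close>, multiplication by \<open>a + b i\<close> maps the one circle injectively into the
  other, because the norm \<open>x\<^sup>2 + y\<^sup>2\<close> of \<open>x + y i\<close> is multiplicative.\<close>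

lemma card_circle_le:
  fixes c d :: "'a::{field,finite}"
  assumes "c \<noteq> 0" and "d \<noteq> 0"
  shows "card (circle c) \<le> card (circle d)"
proof -
  obtain a b where ab: "a^2 + b^2 = d / c"
    by (rule sum_of_two_squares_exists)
  let ?f = "\<lambda>(x, y). (a * x - b * y, b * x + a * y)"
  have "inj ?f"
  proof (rule injI)
    fix p p'
    assume "?f p = ?f p'"
    moreover obtain x y x' y' where p: "p = (x, y)" "p' = (x', y')"
      by (cases p, cases p')
    ultimately have eq: "a * x - b * y = a * x' - b * y'" "b * x + a * y = b * x' + a * y'"
      by simp_all
    have "(a^2 + b^2) * s = a * (a * s - b * t) + b * (b * s + a * t)"
        "(a^2 + b^2) * t = a * (b * s + a * t) - b * (a * s - b * t)" for s t
      by (simp_all add: power2_eq_square algebra_simps)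
    from this[where s = x and t = y] this[where s = x' and t = y']
    have "(a^2 + b^2) * x = (a^2 + b^2) * x'" "(a^2 + b^2) * y = (a^2 + b^2) * y'"
      by (simp_all only: eq)
    then show "p = p'"
      using ab assms by (simp add: p)
  qed
  moreover have "?f ` circle c \<subseteq> circle d"
  proof (rule image_subsetI)
    fix p
    assume "p \<in> circle c"
    moreover obtain x y where p: "p = (x, y)"
      by (cases p)
    ultimately have "x^2 + y^2 = c"
      by (simp add: circle_def)
    moreover have "(a * x - b * y)^2 + (b * x + a * y)^2 = (a^2 + b^2) * (x^2 + y^2)"
      by (simp add: power2_eq_square algebra_simps)
    ultimately show "?f p \<in> circle d"
      using ab assms by (simp add: circle_def p)
  qed
  ultimately show ?thesis
    by (intro card_inj_on_le[of ?f]) (auto intro: inj_on_subset)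
qed

lemma card_circle_le_fst:
  "card (circle c) \<le> 2 * card (fst ` circle c)" for c :: "'a::{field,finite}"
proof -
  define w where "w = (\<lambda>x. SOME y. (x, y) \<in> circle c)"
  define f where "f = (\<lambda>(x, s). (x, if s then w x else - w x))"
  have "p \<in> f ` (fst ` circle c \<times> UNIV)" if "p \<in> circle c" for p
  proof -
    obtain x y where p: "p = (x, y)" by fastforce
    with that have "(x, w x) \<in> circle c"
      unfolding w_def by (auto intro: someI)
    then have "x^2 + w x ^ 2 = x^2 + y^2"
      using that p by (simp add: circle_def)
    then have "y = w x \<or> y = - w x"
      by (metis add_left_cancel power2_eq_iff)
    then have "p = f (x, True) \<or> p = f (x, False)"
      by (simp add: f_def p)
    moreover have "x \<in> fst ` circle c"
      using that p by force
    ultimately show ?thesis by blast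
  qed
  then have "card (circle c) \<le> card (f ` (fst ` circle c \<times> UNIV))"
    by (intro card_mono) auto
  also have "\<dots> \<le> card (fst ` circle c \<times> (UNIV :: bool set))"
    by (intro card_image_le) simp
  finally show ?thesis
    by (simp add: card_cartesian_product mult.commute)
qed

lemma square_root_char_2:
  fixes c :: "'a::{field,finite}"
  assumes "(2::'a) = 0"
  obtains x where "x^2 = c"
proof -
  have "inj (\<lambda>x::'a. x^2)"
  proof (rule injI)
    fix x y :: 'a
    assume "x^2 = y^2"
    moreover have "(x - y)^2 = x^2 - y^2 + 2 * (y^2 - x * y)"
      by (simp add: power2_eq_square algebra_simps)
    ultimately have "(x - y)^2 = 0"
      using assms by simp
    then show "x = y" by simp
  qed
  then have "surj (\<lambda>x::'a. x^2)"
    by (simp add: finite_UNIV_inj_surj)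
  then show thesis
    using that by (metis surjD)
qed

text \<open>This is the counting argument that finds a trace realised by a conjugating matrix
  but by no matrix whose image has even order. In characteristic 2 the condition on \<open>\<tau>\<close> just says \<open>\<tau> \<noteq> 0\<close>, and
  the square root of \<open>c\<close> will do.\<close>

lemma exists_trace:
  fixes c :: "'a::{field,finite}"
  assumes c: "c \<noteq> 0"
  obtains \<tau> w where "\<tau>^2 + w^2 = c" and "\<And>b. b \<noteq> 0 \<Longrightarrow> \<tau>^2 + 4 * b^2 \<noteq> 4"
proof (cases "(2::'a) = 0")
  case True
  then have four: "(4::'a) = 0"
    by (metis mult_2 add_0_right numeral_Bit0 mult_zero_left)
  obtain \<tau> where "\<tau>^2 = c"
    using square_root_char_2[OF True] by blast
  then show thesis
    using c four by (intro that[of \<tau> 0]) auto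
next
  case False
  then have four: "(4::'a) \<noteq> 0"
    by (metis mult_2 mult_eq_0_iff numeral_Bit0)
  define U where "U = {\<tau>::'a. \<exists>b. b \<noteq> 0 \<and> \<tau>^2 + 4 * b^2 = 4}"
  define u where "u = (\<lambda>\<tau>::'a. SOME b. b \<noteq> 0 \<and> \<tau>^2 + 4 * b^2 = 4)"
  have u: "u \<tau> \<noteq> 0" "\<tau>^2 + 4 * u \<tau> ^ 2 = 4" if "\<tau> \<in> U" for \<tau>
    using that someI_ex[of "\<lambda>b. b \<noteq> 0 \<and> \<tau>^2 + 4 * b^2 = 4"] by (auto simp: U_def u_def)
  \<comment> \<open>Each \<open>\<tau> \<in> U\<close> contributes the two points \<open>(\<tau>, 2 b)\<close> and \<open>(\<tau>, - 2 b)\<close> with \<open>b = u \<tau>\<close>.\<close>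
  define f where "f = (\<lambda>(\<tau>, s). (\<tau>, if s then 2 * u \<tau> else - (2 * u \<tau>)))"
  have neq: "2 * x \<noteq> - (2 * x)" if "x \<noteq> 0" for x :: 'a
  proof
    assume "2 * x = - (2 * x)"
    then have "2 * x + 2 * x = 0"
      by (rule eq_neg_iff_add_eq_0[THEN iffD1])
    moreover have "2 * x + 2 * x = 4 * x" by simp
    ultimately show False
      using that four by (metis mult_eq_0_iff)
  qed
  have "inj_on f (U \<times> UNIV)"
    using neq u(1) by (fastforce simp: inj_on_def f_def split: if_splits)
  moreover have "f ` (U \<times> UNIV) \<subseteq> circle 4 - {(2, 0)}"
    using u False by (auto simp: f_def circle_def power_mult_distrib split: if_splits)
  moreover have "card (circle (4::'a) - {(2, 0)}) < card (circle (4::'a))"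
    by (rule card_Diff1_less) (simp_all add: circle_def)
  ultimately have "card (U \<times> (UNIV :: bool set)) < card (circle (4::'a))"
    using card_mono[of "circle 4 - {(2, 0)}" "f ` (U \<times> UNIV)"]
      card_image[of f "U \<times> UNIV"] by (simp del: card_Diff_insert)
  also have "\<dots> \<le> 2 * card (fst ` circle c)"
    using card_circle_le[OF four c] card_circle_le_fst[of c] by linarith
  finally have "card U < card (fst ` circle c)"
    by (simp add: card_cartesian_product)
  then have "\<not> fst ` circle c \<subseteq> U"
    using card_mono[of U "fst ` circle c"] by force
  then obtain p where p: "p \<in> circle c" "fst p \<notin> U"
    by blast
  obtain \<tau> w where "p = (\<tau>, w)"
    by (cases p)
  with p have "\<tau>^2 + w^2 = c" "\<tau> \<notin> U"
    by (simp_all add: circle_def)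
  then show thesis
    by (intro that[of \<tau> w]) (auto simp: U_def)
qed

section \<open>Cosets of scalar matrices\<close>

lemma PSL2_carrierE:
  assumes "t \<in> carrier (PSL2 F)"
  obtains A where "det A = 1" and "t = SL2_scalars F #>\<^bsub>SL2 F\<^esub> A"
  using assms by (auto simp: PSL2_def carrier_FactGroup SL2_def)

lemma PSL2_carrierI:
  "det A = 1 \<Longrightarrow> SL2_scalars F #>\<^bsub>SL2 F\<^esub> A \<in> carrier (PSL2 F)"
  by (auto simp: PSL2_def carrier_FactGroup SL2_def)

lemma PSL2_one: "\<one>\<^bsub>PSL2 F\<^esub> = SL2_scalars F"
  by (simp add: PSL2_def)

lemma coset_eq_scalars_iff:
  assumes "det A = 1"
  shows "SL2_scalars F #>\<^bsub>SL2 F\<^esub> A = SL2_scalars F \<longleftrightarrow> (\<exists>c. A = mat c)"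
proof -
  interpret group "SL2 F" by (rule group_SL2)
  have sub: "subgroup (SL2_scalars F) (SL2 F)"
    using normal_SL2_scalars by (rule normal_imp_subgroup)
  have A: "A \<in> carrier (SL2 F)"
    using assms by (simp add: SL2_def)
  have "SL2_scalars F #>\<^bsub>SL2 F\<^esub> A = SL2_scalars F \<longleftrightarrow> A \<in> SL2_scalars F"
    using rcos_self[OF A sub] coset_join2[OF A sub] by auto
  then show ?thesis
    using assms by (simp add: SL2_scalars_def SL2_def)
qed

lemma PSL2_mult:
  assumes "det A = 1" and "det B = 1"
  shows "(SL2_scalars F #>\<^bsub>SL2 F\<^esub> A) \<otimes>\<^bsub>PSL2 F\<^esub> (SL2_scalars F #>\<^bsub>SL2 F\<^esub> B)
    = SL2_scalars F #>\<^bsub>SL2 F\<^esub> (A ** B)"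
  using normal.rcos_sum[OF normal_SL2_scalars, of A F B] assms
  by (simp add: PSL2_def SL2_def)

lemma coset_uminus:
  assumes "det B = 1"
  shows "SL2_scalars F #>\<^bsub>SL2 F\<^esub> (- B) = SL2_scalars F #>\<^bsub>SL2 F\<^esub> B"
proof -
  interpret P: group "PSL2 F" by (rule group_PSL2)
  have m1: "det (mat (-1) :: 'a^2^2) = 1"
    by (simp add: mat2_simps)
  have "- B = mat (-1) ** B"
    by (simp add: mat2_simps)
  moreover have "SL2_scalars F #>\<^bsub>SL2 F\<^esub> mat (-1) = \<one>\<^bsub>PSL2 F\<^esub>"
    using coset_eq_scalars_iff[OF m1] by (auto simp: PSL2_one)
  ultimately show ?thesis
    using PSL2_mult[OF m1 assms, of F] PSL2_carrierI[OF assms, of F] by simp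
qed

text \<open>By Cayley--Hamilton, \<open>trace A\<close> times \<open>A\<close> equals \<open>A\<^sup>2 + 1\<close>, which is scalar if \<open>A\<close> represents an
  involution.\<close>

lemma involution_coset:
  fixes A :: "'a::field^2^2"
  assumes A: "det A = 1" and inv: "involution (PSL2 F) (SL2_scalars F #>\<^bsub>SL2 F\<^esub> A)"
  shows "trace A = 0" and "A \<noteq> mat c"
proof -
  interpret P: group "PSL2 F" by (rule group_PSL2)
  let ?t = "SL2_scalars F #>\<^bsub>SL2 F\<^esub> A"
  have t: "?t \<in> carrier (PSL2 F)" and ord: "P.ord ?t = 2"
    using inv by (simp_all add: involution_def)
  have "?t \<noteq> \<one>\<^bsub>PSL2 F\<^esub>"
    using ord by auto
  then have nonscalar: "\<And>c. A \<noteq> mat c"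
    using coset_eq_scalars_iff[OF A] by (auto simp: PSL2_one)
  then show "A \<noteq> mat c" .
  have "?t \<otimes>\<^bsub>PSL2 F\<^esub> ?t = \<one>\<^bsub>PSL2 F\<^esub>"
    using P.pow_ord_eq_1[OF t] t by (simp add: ord numeral_2_eq_2)
  then have "SL2_scalars F #>\<^bsub>SL2 F\<^esub> (A ** A) = SL2_scalars F"
    using A by (simp add: PSL2_mult PSL2_one)
  then obtain c where "A ** A = mat c"
    using coset_eq_scalars_iff[of "A ** A"] A by (auto simp: det_mul)
  moreover have "mat c + mat 1 = (mat (c + 1) :: 'a^2^2)"
    by (simp add: mat2_simps)
  ultimately have "mat (trace A) ** A = mat (c + 1)"
    using Cayley_Hamilton_2[of A] A by (metis diff_add_cancel)
  then have "A = mat ((c + 1) / trace A)" if "trace A \<noteq> 0"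
    using that by (simp add: mat2_eq_iff matrix_matrix_mult_def sum_2 mat_def field_simps)
  with nonscalar show "trace A = 0" by blast
qed

text \<open>An element of even order has an involution among its powers, and this restricts its trace:
  if \<open>h\<close> represents that involution and \<open>g = a + b h\<close>, then \<open>trace g = 2 a\<close> with \<open>a\<^sup>2 + b\<^sup>2 = 1\<close>, and
  \<open>b = 0\<close> would make \<open>g\<close> scalar.\<close>

lemma odd_ord_coset:
  fixes g :: "'a::{field,finite}^2^2"
  assumes g: "det g = 1" and tr: "\<And>b. b \<noteq> 0 \<Longrightarrow> (trace g)^2 + 4 * b^2 \<noteq> 4"
  shows "odd (group.ord (PSL2 F) (SL2_scalars F #>\<^bsub>SL2 F\<^esub> g))"
proof
  interpret P: group "PSL2 F" by (rule group_PSL2)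
  interpret S: group "SL2 F" by (rule group_SL2)
  let ?\<pi> = "\<lambda>A. SL2_scalars F #>\<^bsub>SL2 F\<^esub> A"
  have gS: "g \<in> carrier (SL2 F)"
    using g by (simp add: SL2_def)
  have gP: "?\<pi> g \<in> carrier (PSL2 F)"
    using g by (rule PSL2_carrierI)
  assume "even (P.ord (?\<pi> g))"
  then obtain m where m: "P.ord (?\<pi> g) = 2 * m" by blast
  have "m \<noteq> 0"
    using P.ord_ge_1[OF _ gP] m by simp
  define h where "h = g [^]\<^bsub>SL2 F\<^esub> m"
  have "h \<in> carrier (SL2 F)"
    using gS by (simp add: h_def)
  then have h: "det h = 1"
    by (simp add: SL2_def)
  have "P.ord (?\<pi> h) = 2"
    using P.ord_pow[OF gP, of m] m \<open>m \<noteq> 0\<close> normal.FactGroup_pow[OF normal_SL2_scalars gS, of m]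
    by (simp add: h_def PSL2_def)
  then have "involution (PSL2 F) (?\<pi> h)"
    using PSL2_carrierI[OF h] by (simp add: involution_def)
  note trh = involution_coset[OF h this]
  have "g ** h = h ** g"
    using S.nat_pow_comm[OF gS, of 1 m] gS by (simp add: h_def SL2_def)
  then obtain a b where ab: "g = mat a + mat b ** h"
    using commutant_nonscalar[OF trh(2)] by blast
  have "trace g = 2 * a + b * trace h"
    by (simp add: ab mat2_simps algebra_simps)
  moreover have "det g = a^2 + a * b * trace h + b^2 * det h"
    by (simp add: ab mat2_simps power2_eq_square algebra_simps)
  then have "a^2 + b^2 = 1"
    using g h trh by simp
  ultimately have "(trace g)^2 + 4 * b^2 = 4"
    using trh by (simp add: power_mult_distrib flip: distrib_left)
  then have "b = 0"
    using tr by blast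
  then have "g = mat a"
    by (simp add: ab mat2_simps)
  then have "?\<pi> g = \<one>\<^bsub>PSL2 F\<^esub>"
    using coset_eq_scalars_iff[OF g] by (auto simp: PSL2_one)
  then show False
    using m by simp
qed

section \<open>Conjugating matrices with a prescribed trace\<close>

lemma conj_generic:
  fixes A B :: "'a::{field,finite}^2^2"
  assumes A: "det A = 1" "trace A = 0" and B: "det B = 1" "trace B = 0"
    and ne: "trace (A ** B) \<noteq> 2"
  obtains g where "det g = 1" and "A ** g = g ** B"
    and "\<And>b. b \<noteq> 0 \<Longrightarrow> (trace g)^2 + 4 * b^2 \<noteq> 4"
proof -
  define c where "c = 2 - trace (A ** B)"
  have c: "c \<noteq> 0" using ne by (simp add: c_def)
  obtain \<tau> w where \<tau>: "\<tau>^2 + w^2 = c" "\<And>b. b \<noteq> 0 \<Longrightarrow> \<tau>^2 + 4 * b^2 \<noteq> 4"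
    using exists_trace[OF c] by blast
  \<comment> \<open>The coefficients solve \<open>c x = \<tau>\<close> and \<open>c (x\<^sup>2 + y\<^sup>2) = 1\<close>.\<close>
  define g where "g = (A + B) ** (mat (w / c) - mat (\<tau> / c) ** B)"
  note g = traceless_conj[OF A B, where x = "\<tau> / c" and y = "w / c", folded c_def g_def]
  have "det g = (\<tau>^2 + w^2) / c"
    unfolding g(2) using c by (simp add: power2_eq_square field_simps)
  then have "det g = 1"
    using c by (simp add: \<tau>(1))
  moreover have "trace g = \<tau>"
    using c by (simp add: g(3))
  ultimately show thesis
    using that g(1) \<tau>(2) by blast
qed

text \<open>In characteristic 2, \<open>A\<close> and \<open>B\<close> are unipotent, and \<open>trace (A B) = 0\<close> means that they fix the
  same line. So \<open>B - 1\<close> is \<open>l (A - 1)\<close> for some \<open>l\<close>, and a matrix \<open>g\<close> that achieves this rescaling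
  has trace \<open>x (1 + l)\<close>, which vanishes only if \<open>l = 1\<close>, that is, \<open>A = B\<close>.\<close>

lemma conj_char_2:
  fixes A B :: "'a::{field,finite}^2^2"
  assumes two: "(2::'a) = 0"
    and A: "det A = 1" "trace A = 0" "A \<noteq> mat 1" and B: "det B = 1" "trace B = 0" "B \<noteq> mat 1"
    and AB: "trace (A ** B) = 0" "A \<noteq> B"
  obtains g where "det g = 1" and "A ** g = g ** B" and "trace g \<noteq> 0"
proof -
  define N M where "N = A - mat 1" and "M = B - mat 1"
  have AN: "A = mat 1 + N" and BM: "B = mat 1 + M"
    by (simp_all add: N_def M_def)
  have tr: "trace (C - mat 1) = trace C - 2" and det: "det (C - mat 1) = det C - trace C + 1"
    for C :: "'a^2^2"
    by (simp_all add: mat2_simps algebra_simps)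
  have N: "trace N = 0" "det N = 0" "N \<noteq> 0" and M: "trace M = 0" "det M = 0" "M \<noteq> 0"
    using A B by (simp_all add: N_def M_def tr det two)
  have "trace (N ** M) = trace (A ** B) - trace A - trace B + 2"
    by (simp add: N_def M_def mat2_simps algebra_simps)
  then have "trace (N ** M) = 0"
    by (simp add: AB A B two)
  then obtain l where l: "M = mat l ** N"
    using nilpotent_proportional[OF N M(1,2)] by blast
  have "l \<noteq> 0"
    using M(3) l by (auto simp: mat2_simps)
  have "l \<noteq> 1"
    using AB(2) l by (auto simp: AN BM)
  obtain x where x: "x^2 = 1 / l"
    using square_root_char_2[OF two] by blast
  then have "x^2 * l = 1"
    using \<open>l \<noteq> 0\<close> by simp
  then obtain g where g: "det g = 1" "N ** g = g ** (mat l ** N)" "trace g = x * (1 + l)"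
    using nilpotent_rescale[OF N] by blast
  have "A ** g = g ** B"
    using g(2) unfolding AN BM l[symmetric] by (simp add: mat2_simps algebra_simps)
  moreover have "trace g \<noteq> 0"
  proof -
    have "1 + l \<noteq> 0"
    proof
      assume l: "1 + l = 0"
      have "1 - l = 2 - (1 + l)" by simp
      also have "\<dots> = 0" by (simp only: l two diff_zero)
      finally show False using \<open>l \<noteq> 1\<close> by simp
    qed
    moreover have "x \<noteq> 0"
      using x \<open>l \<noteq> 0\<close> by auto
    ultimately show ?thesis
      by (simp add: g(3))
  qed
  ultimately show thesis
    using that g(1) by blast
qed

section \<open>Conjugacy of involutions\<close>

lemma PSL2_conj_odd:
  fixes F :: "'a::{field,finite} itself"
  assumes "det A = 1" "det B = 1" "det g = 1" "A ** g = g ** B"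
    and "\<And>b. b \<noteq> 0 \<Longrightarrow> (trace g)^2 + 4 * b^2 \<noteq> 4"
  defines "\<pi> \<equiv> \<lambda>A. SL2_scalars F #>\<^bsub>SL2 F\<^esub> A"
  shows "\<exists>x \<in> carrier (PSL2 F). odd (group.ord (PSL2 F) x) \<and>
    \<pi> B = inv\<^bsub>PSL2 F\<^esub> x \<otimes>\<^bsub>PSL2 F\<^esub> \<pi> A \<otimes>\<^bsub>PSL2 F\<^esub> x"
proof (intro bexI conjI)
  interpret P: group "PSL2 F" by (rule group_PSL2)
  have carr: "\<pi> A \<in> carrier (PSL2 F)" "\<pi> B \<in> carrier (PSL2 F)" "\<pi> g \<in> carrier (PSL2 F)"
    using assms(1-3) by (simp_all add: \<pi>_def PSL2_carrierI)
  then show "\<pi> g \<in> carrier (PSL2 F)" by simp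
  show "odd (P.ord (\<pi> g))"
    unfolding \<pi>_def using assms(3,5) by (rule odd_ord_coset)
  have "\<pi> A \<otimes>\<^bsub>PSL2 F\<^esub> \<pi> g = \<pi> g \<otimes>\<^bsub>PSL2 F\<^esub> \<pi> B"
    using assms(1-4) by (simp add: \<pi>_def PSL2_mult)
  then show "\<pi> B = inv\<^bsub>PSL2 F\<^esub> (\<pi> g) \<otimes>\<^bsub>PSL2 F\<^esub> \<pi> A \<otimes>\<^bsub>PSL2 F\<^esub> \<pi> g"
    using carr by (simp add: P.m_assoc P.inv_solve_left)
qed

theorem corollary2p4:
  fixes q :: nat
    and t1 t2 :: "('a::{field,finite}^2^2) set"
  assumes "primepow q"
    and "CARD('a) = q"
    and "involution (PSL2 TYPE('a)) t1"
    and "involution (PSL2 TYPE('a)) t2"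
  shows "\<exists>g \<in> carrier (PSL2 TYPE('a)).
           odd (group.ord (PSL2 TYPE('a)) g) \<and>
           t2 = inv\<^bsub>PSL2 TYPE('a)\<^esub> g \<otimes>\<^bsub>PSL2 TYPE('a)\<^esub> t1 \<otimes>\<^bsub>PSL2 TYPE('a)\<^esub> g"
proof -
  let ?\<pi> = "\<lambda>A. SL2_scalars TYPE('a) #>\<^bsub>SL2 TYPE('a)\<^esub> A"
  obtain A B where A: "det A = 1" and t1: "t1 = ?\<pi> A" and B: "det B = 1" and t2: "t2 = ?\<pi> B"
    using assms(3,4) unfolding involution_def by (metis PSL2_carrierE)
  note trA = involution_coset[OF A assms(3)[unfolded t1]]
  note trB = involution_coset[OF B assms(4)[unfolded t2]]
  consider "trace (A ** B) \<noteq> 2" | "trace (A ** B) = 2" "(2::'a) \<noteq> 0"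
    | "trace (A ** B) = 2" "(2::'a) = 0" "A \<noteq> B" | "A = B"
    by blast
  then show ?thesis
  proof cases
    case 1
    obtain g where "det g = 1" "A ** g = g ** B" "\<And>b. b \<noteq> 0 \<Longrightarrow> (trace g)^2 + 4 * b^2 \<noteq> 4"
      using conj_generic[OF A trA(1) B trB(1) 1] by blast
    then show ?thesis
      unfolding t1 t2 by (rule PSL2_conj_odd[OF A B])
  next
    case 2
    have B': "det (- B) = 1" "trace (- B) = 0"
      using B trB(1) by (simp_all add: det_2 trace_def sum_2 add_eq_0_iff)
    have "trace (A ** (- B)) = - trace (A ** B)"
      by (simp add: mat2_simps)
    moreover have "- 2 \<noteq> (2::'a)"
    proof
      assume "- 2 = (2::'a)"
      then have "2 + 2 = (0::'a)"
        by (metis add.right_inverse)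
      then have "2 * 2 = (0::'a)"
        by simp
      with 2 show False by (metis mult_eq_0_iff)
    qed
    ultimately have "trace (A ** (- B)) \<noteq> 2"
      using 2 by simp
    then obtain g where "det g = 1" "A ** g = g ** (- B)"
        "\<And>b. b \<noteq> 0 \<Longrightarrow> (trace g)^2 + 4 * b^2 \<noteq> 4"
      using conj_generic[OF A trA(1) B'] by blast
    then show ?thesis
      unfolding t1 t2 coset_uminus[OF B, symmetric] by (rule PSL2_conj_odd[OF A B'(1)])
  next
    case 3
    then have four: "(4::'a) = 0"
      by (metis mult_2 add_0_right numeral_Bit0 mult_zero_left)
    obtain g where g: "det g = 1" "A ** g = g ** B" "trace g \<noteq> 0"
      using conj_char_2[OF 3(2) A trA B trB] 3 by auto
    then have "(trace g)^2 + 4 * b^2 \<noteq> 4" for b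
      by (simp add: four)
    with g show ?thesis
      unfolding t1 t2 by (intro PSL2_conj_odd[OF A B])
  next
    case 4
    interpret P: group "PSL2 TYPE('a)" by (rule group_PSL2)
    have "t1 \<in> carrier (PSL2 TYPE('a))"
      using assms(3) by (simp add: involution_def)
    with 4 show ?thesis
      by (intro bexI[of _ "\<one>\<^bsub>PSL2 TYPE('a)\<^esub>"]) (simp_all add: t1 t2)
  qed
qed

end
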